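(* Let $X$ be a minimal shift space on a finite alphabet $A$ and $\varphi\colon A^*\to G$ be a (monoid) morphism onto a finite group $G$. Let $H$ be a subgroup of $G$. (i) If a cobounding map $\alpha\colon X\to H\backslash G$ takes constant value $Hg$ on a cylinder $[u]_X$ (with $u\in\mathcal L(X)$, $g\in G$), then $\varphi(\mathcal R_X(u))\subseteq g^{-1}Hg$. (ii) If a word $u\in\mathcal L(X)$ satisfies $\varphi(\mathcal R_X(u))\subseteq H$, then there exists a cobounding map $\alpha\colon X\to H\backslash G$ which takes constant value $H$ on $[u]_X$. (iii) A cobounding map $\alpha\colon X\to H\backslash G$ is minimal if and only if, whenever $u\in\mathcal L(X)$ and $g\in G$ are such that $\alpha$ takes constant value $Hg$ on $[u]_X$, the set $\varphi(\mathcal R_X(u))$ generates the subgroup $g^{-1}Hg$.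
   Context: A shift space on a finite alphabet $A$ is a nonempty closed subset $X\subseteq A^{\mathbb Z}$ invariant under the shift map $S((x_n)_n)=(x_{n+1})_n$, such that every letter of $A$ occurs in some element of $X$; it is minimal if it has no proper nonempty closed shift-invariant subset. Write $x_{[i,j)}=x_i\cdots x_{j-1}$. The language $\mathcal L(X)$ is the set of all finite words $x_{[i,j)}$, $x\in X$, $i\le j$. For $u\in\mathcal L(X)$, $[u]_X=\{x\in X:x_{[0,|u|)}=u\}$, and the set $\mathcal R_X(u)$ of return words to $u$ is the set of nonempty words $r\in A^*$ such that $ru\in\mathcal L(X)$ and $ru$ has exactly two occurrences of $u$ as a factor, one as a prefix and one as a suffix. For a subgroup $H\le G$, $H\backslash G$ is the set of right cosets $Hg$ (discrete, with right action of $G$). A cobounding map (for $\varphi$ on $X$, mod $H$) is a continuous map $\alpha\colon X\to H\backslash G$ with $\alpha(Sx)=\alpha(x)\varphi(x_0)$ for all $x\in X$. For cobounding maps $\alpha$ mod $H$ and $\beta$ mod $K$, write $\alpha\le\beta$ if $H\le K$ and $\alpha^{-1}(Hg)\subseteq\beta^{-1}(Kg)$ for all $g\in G$. A cobounding map is minimal if it is minimal for this partial order among all cobounding maps (over all subgroups of $G$). *)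

theory Defs
  imports "HOL-Analysis.Abstract_Topology" "HOL-Analysis.Product_Topology"
    "HOL-Analysis.Function_Topology" "HOL-Algebra.Coset" "HOL-Algebra.Generated_Groups"
begin

definition full_shift :: "'a set \<Rightarrow> (int \<Rightarrow> 'a) topology" where
  "full_shift A = product_topology (\<lambda>_. discrete_topology A) UNIV"

definition shift :: "(int \<Rightarrow> 'a) \<Rightarrow> int \<Rightarrow> 'a" where
  "shift x = (\<lambda>n. x (n + 1))"

definition shift_space :: "'a set \<Rightarrow> (int \<Rightarrow> 'a) set \<Rightarrow> bool" where
  "shift_space A X \<longleftrightarrow> X \<noteq> {} \<and> closedin (full_shift A) X \<and> shift ` X = X
     \<and> (\<forall>a\<in>A. \<exists>x\<in>X. \<exists>n. x n = a)"

definition minimal_shift_space :: "'a set \<Rightarrow> (int \<Rightarrow> 'a) set \<Rightarrow> bool" where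
  "minimal_shift_space A X \<longleftrightarrow> shift_space A X
     \<and> (\<forall>Y. Y \<subseteq> X \<and> Y \<noteq> {} \<and> closedin (full_shift A) Y \<and> shift ` Y = Y \<longrightarrow> Y = X)"

text \<open>The word \<open>x\<^bsub>[i,j)\<^esub>\<close>; note that \<open>[i..j - 1]\<close> is the list of integers from \<open>i\<close> to
  \<open>j - 1\<close> inclusive, hence empty for \<open>i = j\<close>.\<close>
definition segment :: "(int \<Rightarrow> 'a) \<Rightarrow> int \<Rightarrow> int \<Rightarrow> 'a list" where
  "segment x i j = map x [i..j - 1]"

definition language :: "(int \<Rightarrow> 'a) set \<Rightarrow> 'a list set" where
  "language X = {segment x i j | x i j. x \<in> X \<and> i \<le> j}"

definition cylinder :: "(int \<Rightarrow> 'a) set \<Rightarrow> 'a list \<Rightarrow> (int \<Rightarrow> 'a) set" where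
  "cylinder X u = {x \<in> X. segment x 0 (int (length u)) = u}"

definition occurrences :: "'a list \<Rightarrow> 'a list \<Rightarrow> nat set" where
  "occurrences u w = {i. i + length u \<le> length w \<and> take (length u) (drop i w) = u}"

definition return_words :: "(int \<Rightarrow> 'a) set \<Rightarrow> 'a list \<Rightarrow> 'a list set" where
  "return_words X u =
     {r. r \<noteq> [] \<and> r @ u \<in> language X \<and> occurrences u (r @ u) = {0, length r}}"

definition word_monoid :: "'a set \<Rightarrow> 'a list monoid" where
  "word_monoid A = \<lparr>carrier = lists A, mult = (@), one = []\<rparr>"

text \<open>The library's \<open>hom\<close> (hence \<open>epi\<close>) does not mention the unit, so its
  preservation is a separate conjunct.\<close>
definition onto_monoid_morphism ::
  "'a set \<Rightarrow> ('g, 'm) monoid_scheme \<Rightarrow> ('a list \<Rightarrow> 'g) \<Rightarrow> bool" where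
  "onto_monoid_morphism A G \<phi> \<longleftrightarrow> \<phi> \<in> epi (word_monoid A) G \<and> \<phi> [] = \<one>\<^bsub>G\<^esub>"

definition cobounding ::
  "'a set \<Rightarrow> (int \<Rightarrow> 'a) set \<Rightarrow> ('g, 'm) monoid_scheme \<Rightarrow> ('a list \<Rightarrow> 'g) \<Rightarrow>
   'g set \<Rightarrow> ((int \<Rightarrow> 'a) \<Rightarrow> 'g set) \<Rightarrow> bool" where
  "cobounding A X G \<phi> H \<alpha> \<longleftrightarrow> subgroup H G
     \<and> continuous_map (subtopology (full_shift A) X) (discrete_topology (rcosets\<^bsub>G\<^esub> H)) \<alpha>
     \<and> (\<forall>x\<in>X. \<alpha> (shift x) = \<alpha> x #>\<^bsub>G\<^esub> \<phi> [x 0])"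

definition cobounding_le ::
  "(int \<Rightarrow> 'a) set \<Rightarrow> ('g, 'm) monoid_scheme \<Rightarrow>
   'g set \<Rightarrow> ((int \<Rightarrow> 'a) \<Rightarrow> 'g set) \<Rightarrow> 'g set \<Rightarrow> ((int \<Rightarrow> 'a) \<Rightarrow> 'g set) \<Rightarrow> bool" where
  "cobounding_le X G H \<alpha> K \<beta> \<longleftrightarrow> H \<subseteq> K
     \<and> (\<forall>g\<in>carrier G. {x \<in> X. \<alpha> x = H #>\<^bsub>G\<^esub> g} \<subseteq> {x \<in> X. \<beta> x = K #>\<^bsub>G\<^esub> g})"

text \<open>Cobounding maps are only meaningful on \<open>X\<close>, so two of them are identified when they
  have the same subgroup and agree on \<open>X\<close>.\<close>
definition minimal_cobounding ::
  "'a set \<Rightarrow> (int \<Rightarrow> 'a) set \<Rightarrow> ('g, 'm) monoid_scheme \<Rightarrow> ('a list \<Rightarrow> 'g) \<Rightarrow>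
   'g set \<Rightarrow> ((int \<Rightarrow> 'a) \<Rightarrow> 'g set) \<Rightarrow> bool" where
  "minimal_cobounding A X G \<phi> H \<alpha> \<longleftrightarrow> cobounding A X G \<phi> H \<alpha>
     \<and> (\<forall>K \<beta>. cobounding A X G \<phi> K \<beta> \<and> cobounding_le X G K \<beta> H \<alpha>
           \<longrightarrow> K = H \<and> (\<forall>x\<in>X. \<beta> x = \<alpha> x))"

end

theory Submission imports Defs begin

text \<open>Write \<open>c x n\<close> for the value of \<open>\<phi>\<close> along the orbit from \<open>x\<close> to \<open>S\<^sup>n x\<close>, so that every
  cobounding map satisfies \<open>\<alpha> (S\<^sup>n x) = \<alpha> x \<cdot> c x n\<close>. Comparing the two ends of a return
  word gives (i). Conversely, by minimality every \<open>x\<close> enters the cylinder of \<open>u\<close> at some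
  time \<open>n\<close>, possibly negative; if \<open>\<phi>\<close> maps the return words of \<open>u\<close> into \<open>g\<^sup>-\<^sup>1 H g\<close>, the coset
  \<open>H g (c x n)\<^sup>-\<^sup>1\<close> does not depend on the choice of \<open>n\<close>, because the word read between two
  visits is a product of return words, and it defines a cobounding map with value \<open>H g\<close>
  on the cylinder. For (iii), this construction applied to the subgroup generated by the
  images of the return words produces a cobounding map below \<open>\<alpha>\<close>; and
  a cobounding map below \<open>\<alpha>\<close> is constant on some cylinder, where (i) bounds its subgroup.\<close>

section \<open>Words and cylinders\<close>

text \<open>Integer powers of the shift. Negative exponents are needed because a visit to a cylinder
  may be looked for in the past.\<close>

definition shift_by :: "int \<Rightarrow> (int \<Rightarrow> 'a) \<Rightarrow> int \<Rightarrow> 'a" where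
  "shift_by k x = (\<lambda>n. x (n + k))"

lemma shift_by_simps [simp]:
  "shift_by 0 x = x"
  "shift_by i (shift_by j x) = shift_by (i + j) x"
  by (auto simp: shift_by_def add.assoc)

lemma shift_eq_shift_by: "shift = shift_by 1"
  by (auto simp: shift_def shift_by_def)

lemma length_segment [simp]: "length (segment x i j) = nat (j - i)"
  by (simp add: segment_def)

lemma nth_segment [simp]: "k < nat (j - i) \<Longrightarrow> segment x i j ! k = x (i + int k)"
  by (simp add: segment_def)

lemma set_segment: "set (segment x i j) = x ` {i..<j}"
  by (auto simp: segment_def)

lemma segment_empty [simp]: "j \<le> i \<Longrightarrow> segment x i j = []"
  by (simp add: segment_def)

lemma segment_single [simp]: "segment x i (i + 1) = [x i]"
  by (simp add: segment_def)

lemma segment_shift_by: "segment (shift_by k x) i j = segment x (i + k) (j + k)"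
  by (rule nth_equalityI) (auto simp: shift_by_def algebra_simps)

lemma segment_append:
  "i \<le> j \<Longrightarrow> j \<le> k \<Longrightarrow> segment x i j @ segment x j k = segment x i k"
  by (rule nth_equalityI) (auto simp: nth_append algebra_simps)

lemma segment_cong: "(\<And>k. i \<le> k \<Longrightarrow> k < j \<Longrightarrow> x k = y k) \<Longrightarrow> segment x i j = segment y i j"
  by (auto simp: segment_def)

lemma segment_in_language: "x \<in> X \<Longrightarrow> i \<le> j \<Longrightarrow> segment x i j \<in> language X"
  unfolding language_def by blast

lemma take_drop_segment:
  "i + l \<le> nat (k - j) \<Longrightarrow>
    take l (drop i (segment x j k)) = segment x (j + int i) (j + int i + int l)"
  by (rule nth_equalityI) (auto simp: algebra_simps)

abbreviation occurs_at :: "'a list \<Rightarrow> (int \<Rightarrow> 'a) \<Rightarrow> int \<Rightarrow> bool" where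
  "occurs_at u x n \<equiv> segment x n (n + int (length u)) = u"

text \<open>Passes from factor positions inside a finite word, as in \<open>return_words\<close>, to
  visit times of a point.\<close>

lemma occurrences_segment:
  "occurrences u (segment x j k) = {i. i + length u \<le> nat (k - j) \<and> occurs_at u x (j + int i)}"
  by (auto simp: occurrences_def take_drop_segment)

section \<open>Topology of the full shift\<close>

lemma openin_full_shift_window:
  assumes "finite I" "x ` I \<subseteq> A"
  shows "openin (full_shift A) {y. range y \<subseteq> A \<and> (\<forall>i\<in>I. y i = x i)}"
proof -
  have eq: "{y. range y \<subseteq> A \<and> (\<forall>i\<in>I. y i = x i)} = (\<Pi>\<^sub>E i\<in>UNIV. if i \<in> I then {x i} else A)"
    using assms(2) by (force simp: PiE_def Pi_def extensional_def split: if_splits)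
  have "finite {i. (if i \<in> I then {x i} else A) \<noteq> A}"
    by (rule finite_subset[OF _ assms(1)]) auto
  moreover have "x i \<in> A" if "i \<in> I" for i
    using assms(2) that by blast
  ultimately show ?thesis
    unfolding full_shift_def eq by (intro product_topology_basis) auto
qed

lemma openin_full_shift_contains_window:
  assumes "openin (full_shift A) U" "x \<in> U"
  obtains I where "finite I" "{y. range y \<subseteq> A \<and> (\<forall>i\<in>I. y i = x i)} \<subseteq> U"
proof -
  obtain V where V: "finite {i. V i \<noteq> A}" "x \<in> Pi\<^sub>E UNIV V" "Pi\<^sub>E UNIV V \<subseteq> U"
    using assms unfolding full_shift_def openin_product_topology_alt by auto
  have "{y. range y \<subseteq> A \<and> (\<forall>i\<in>{i. V i \<noteq> A}. y i = x i)} \<subseteq> Pi\<^sub>E UNIV V"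
    using V(2) by (force simp: PiE_def Pi_def)
  then show thesis by (rule that[OF V(1) subset_trans[OF _ V(3)]])
qed

lemma topspace_full_shift: "topspace (full_shift A) = {x. range x \<subseteq> A}"
  by (auto simp: full_shift_def)

text \<open>Continuity into a discrete space is local constancy, and windows on finitely many
  coordinates form a neighbourhood basis. Later proofs use continuity only in this combinatorial
  form.\<close>

lemma continuous_map_full_shift_discrete_iff:
  assumes "X \<subseteq> topspace (full_shift A)"
  shows "continuous_map (subtopology (full_shift A) X) (discrete_topology D) \<alpha> \<longleftrightarrow>
    \<alpha> ` X \<subseteq> D \<and> (\<forall>x\<in>X. \<exists>I. finite I \<and> (\<forall>y\<in>X. (\<forall>i\<in>I. y i = x i) \<longrightarrow> \<alpha> y = \<alpha> x))"
    (is "?L \<longleftrightarrow> ?R")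
proof
  have top: "topspace (subtopology (full_shift A) X) = X"
    using assms by auto
  have ran: "range x \<subseteq> A" if "x \<in> X" for x
    using assms that by (auto simp: topspace_full_shift)
  {
    assume L: ?L
    have im: "\<alpha> ` X \<subseteq> D"
      using continuous_map_image_subset_topspace[OF L] top by simp
    have "\<exists>I. finite I \<and> (\<forall>y\<in>X. (\<forall>i\<in>I. y i = x i) \<longrightarrow> \<alpha> y = \<alpha> x)" if x: "x \<in> X" for x
    proof -
      have "openin (subtopology (full_shift A) X) {y \<in> X. \<alpha> y \<in> {\<alpha> x}}"
        using openin_continuous_map_preimage[OF L, of "{\<alpha> x}"] im x unfolding top by auto
      then obtain U where U: "openin (full_shift A) U" "{y \<in> X. \<alpha> y \<in> {\<alpha> x}} = U \<inter> X"
        unfolding openin_subtopology by blast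
      then have "x \<in> U" using x by blast
      obtain I where I: "finite I" "{y. range y \<subseteq> A \<and> (\<forall>i\<in>I. y i = x i)} \<subseteq> U"
        using openin_full_shift_contains_window[OF U(1) \<open>x \<in> U\<close>] .
      have "\<alpha> y = \<alpha> x" if "y \<in> X" "\<forall>i\<in>I. y i = x i" for y
      proof -
        have "y \<in> U \<inter> X" using I(2) ran[OF that(1)] that by auto
        then show ?thesis unfolding U(2)[symmetric] by simp
      qed
      with I(1) show ?thesis by blast
    qed
    with im show ?R by blast
  }
  {
    assume R: ?R
    have "openin (subtopology (full_shift A) X) {y \<in> X. \<alpha> y \<in> V}" for V
    proof (subst openin_subopen, safe)
      fix x assume x: "x \<in> X" "\<alpha> x \<in> V"
      then obtain I where I: "finite I" "\<forall>y\<in>X. (\<forall>i\<in>I. y i = x i) \<longrightarrow> \<alpha> y = \<alpha> x"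
        using R by blast
      let ?T = "{y. range y \<subseteq> A \<and> (\<forall>i\<in>I. y i = x i)}"
      have "openin (full_shift A) ?T"
        by (rule openin_full_shift_window[OF I(1)]) (use ran[OF x(1)] in blast)
      then have "openin (subtopology (full_shift A) X) (?T \<inter> X)"
        unfolding openin_subtopology by blast
      moreover have "x \<in> ?T \<inter> X" using x(1) ran[OF x(1)] by simp
      moreover have "?T \<inter> X \<subseteq> {y \<in> X. \<alpha> y \<in> V}" using I(2) x(2) by auto
      ultimately show "\<exists>T. openin (subtopology (full_shift A) X) T \<and> x \<in> T
          \<and> T \<subseteq> {y \<in> X. \<alpha> y \<in> V}" by blast
    qed
    then show ?L
      using R top by (auto simp: continuous_map_def)
  }
qed

text \<open>Whether \<open>u\<close> occurs at \<open>n\<close> depends on finitely many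
  coordinates, so the points containing \<open>u\<close> form an open set.\<close>

lemma closedin_avoiding_word:
  assumes "closedin (full_shift A) X"
  shows "closedin (full_shift A) {x \<in> X. \<forall>n. \<not> occurs_at u x n}"
proof -
  have ran: "range x \<subseteq> A" if "x \<in> X" for x
    using closedin_subset[OF assms] that by (auto simp: topspace_full_shift)
  have "openin (full_shift A) {x. range x \<subseteq> A \<and> (\<exists>n. occurs_at u x n)}"
  proof (subst openin_subopen, safe)
    fix x n assume x: "range x \<subseteq> A" and n: "occurs_at u x n"
    let ?I = "{n..<n + int (length u)}"
    let ?T = "{y. range y \<subseteq> A \<and> (\<forall>i\<in>?I. y i = x i)}"
    have "openin (full_shift A) ?T"
      by (rule openin_full_shift_window) (use x in auto)
    moreover have "occurs_at u y n" if "\<forall>i\<in>?I. y i = x i" for y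
      using n segment_cong[of n "n + int (length u)" x y] that by auto
    ultimately show "\<exists>T. openin (full_shift A) T \<and> x \<in> T
        \<and> T \<subseteq> {x. range x \<subseteq> A \<and> (\<exists>n. occurs_at u x n)}"
      using x by (intro exI[of _ ?T]) blast
  qed
  then have "closedin (full_shift A) (X - {x. range x \<subseteq> A \<and> (\<exists>n. occurs_at u x n)})"
    by (rule closedin_diff[OF assms])
  moreover have "X - {x. range x \<subseteq> A \<and> (\<exists>n. occurs_at u x n)}
      = {x \<in> X. \<forall>n. \<not> occurs_at u x n}"
    using ran by blast
  ultimately show ?thesis by simp
qed

lemma shift_by_mem:
  assumes "shift ` X = X" "x \<in> X"
  shows "shift_by k x \<in> X"
proof (induction k rule: int_induct[of _ 0])
  case base
  then show ?case using assms(2) by simp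
next
  case (step1 i)
  have "shift (shift_by i x) \<in> X" using step1 assms(1) by blast
  then show ?case by (simp add: shift_eq_shift_by add.commute)
next
  case (step2 i)
  \<comment> \<open>Going back in time uses that \<open>shift\<close> maps \<open>X\<close> onto
    itself; injectivity of the shift then identifies the preimage.\<close>
  obtain y where y: "y \<in> X" "shift_by i x = shift y" using step2 assms(1) by blast
  have "shift_by (i - 1) x = shift_by (- 1) (shift_by i x)" by simp
  also have "\<dots> = y" unfolding y(2) shift_eq_shift_by by simp
  finally show ?case using y(1) by simp
qed

section \<open>Conjugate subgroups\<close>

context group
begin

text \<open>Replaces products of sets by a test on a single element; the later facts on conjugates
  go through it.\<close>

lemma mem_conjugate_iff:
  assumes "H \<subseteq> carrier G" "g \<in> carrier G"
  shows "x \<in> (inv g <# H) #> g \<longleftrightarrow> x \<in> carrier G \<and> g \<otimes> x \<otimes> inv g \<in> H"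
proof
  assume "x \<in> (inv g <# H) #> g"
  then obtain h where h: "h \<in> H" "x = inv g \<otimes> h \<otimes> g"
    by (auto simp: l_coset_def r_coset_def)
  moreover have "h \<in> carrier G" using h assms by blast
  ultimately show "x \<in> carrier G \<and> g \<otimes> x \<otimes> inv g \<in> H"
    using assms by (simp add: m_assoc) (simp add: m_assoc[symmetric])
next
  assume x: "x \<in> carrier G \<and> g \<otimes> x \<otimes> inv g \<in> H"
  then have "x = inv g \<otimes> (g \<otimes> x \<otimes> inv g) \<otimes> g"
    using assms by (simp add: m_assoc) (simp add: m_assoc[symmetric])
  with x show "x \<in> (inv g <# H) #> g"
    unfolding l_coset_def r_coset_def by blast
qed

lemma subgroup_conjugate:
  assumes "subgroup H G" "g \<in> carrier G"
  shows "subgroup ((inv g <# H) #> g) G"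
proof -
  interpret H: subgroup H G by fact
  note iff = mem_conjugate_iff[OF H.subset assms(2)]
  show ?thesis
  proof (rule subgroupI)
    show "(inv g <# H) #> g \<subseteq> carrier G" using iff by blast
    have "\<one> \<in> (inv g <# H) #> g" using assms(2) by (simp add: iff)
    then show "(inv g <# H) #> g \<noteq> {}" by blast
  next
    fix a assume "a \<in> (inv g <# H) #> g"
    then have a: "a \<in> carrier G" "g \<otimes> a \<otimes> inv g \<in> H" by (auto simp: iff)
    have "inv (g \<otimes> a \<otimes> inv g) = g \<otimes> inv a \<otimes> inv g"
      using a assms(2) by (simp add: inv_mult_group m_assoc)
    with a H.m_inv_closed[OF a(2)] show "inv a \<in> (inv g <# H) #> g" by (simp add: iff)
  next
    fix a b assume "a \<in> (inv g <# H) #> g" "b \<in> (inv g <# H) #> g"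
    then have ab: "a \<in> carrier G" "g \<otimes> a \<otimes> inv g \<in> H" "b \<in> carrier G" "g \<otimes> b \<otimes> inv g \<in> H"
      by (auto simp: iff)
    have "(g \<otimes> a \<otimes> inv g) \<otimes> (g \<otimes> b \<otimes> inv g) = g \<otimes> (a \<otimes> b) \<otimes> inv g"
      using ab assms(2) by (metis inv_closed inv_solve_right m_assoc m_closed)
    with ab H.m_closed[OF ab(2,4)] show "a \<otimes> b \<in> (inv g <# H) #> g" by (simp add: iff)
  qed
qed

lemma conjugate_conjugate_inv:
  assumes "K \<subseteq> carrier G" "g \<in> carrier G"
  shows "(inv g <# (g <# K #> inv g)) #> g = K"
proof -
  have *: "g <# K #> inv g \<subseteq> carrier G"
    by (intro r_coset_subset_G l_coset_subset_G inv_closed assms)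
  have "x \<in> (inv g <# (g <# K #> inv g)) #> g \<longleftrightarrow> x \<in> K" for x
  proof (cases "x \<in> carrier G")
    case True
    have "inv g \<otimes> (g \<otimes> x \<otimes> inv g) \<otimes> g = x"
      using True assms(2) by (simp add: m_assoc) (simp add: m_assoc[symmetric])
    then show ?thesis
      using True assms mem_conjugate_iff[OF * assms(2)]
        mem_conjugate_iff[OF assms(1) inv_closed[OF assms(2)]] by simp
  next
    case False
    then show ?thesis using assms mem_conjugate_iff[OF * assms(2)] by blast
  qed
  then show ?thesis by blast
qed

text \<open>Expressing equality of cosets by membership lets an equality modulo a subgroup pass to
  any larger subgroup.\<close>

lemma rcos_eq_iff:
  assumes "subgroup H G" "a \<in> carrier G" "b \<in> carrier G"
  shows "H #> a = H #> b \<longleftrightarrow> a \<otimes> inv b \<in> H"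
proof
  interpret H: subgroup H G by fact
  {
    assume "H #> a = H #> b"
    then have "a \<in> H #> b" using rcos_self assms by blast
    then obtain h where "h \<in> H" "a = h \<otimes> b" by (auto simp: r_coset_def)
    then show "a \<otimes> inv b \<in> H" using assms(3) by (simp add: m_assoc)
  }
  {
    assume h: "a \<otimes> inv b \<in> H"
    have "a = (a \<otimes> inv b) \<otimes> b" using assms by (simp add: m_assoc)
    with h have "a \<in> H #> b" unfolding r_coset_def by blast
    then show "H #> a = H #> b" using repr_independence assms by blast
  }
qed

end

section \<open>Cobounding maps of a minimal shift space\<close>

locale minimal_shift_morphism = group G
  for G :: "('g, 'm) monoid_scheme" (structure) +
  fixes A :: "'a set" and X :: "(int \<Rightarrow> 'a) set" and \<phi> :: "'a list \<Rightarrow> 'g"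
  assumes minimal: "minimal_shift_space A X"
    and morphism: "onto_monoid_morphism A G \<phi>"
begin

lemma closed_X: "closedin (full_shift A) X"
  and shift_X: "shift ` X = X"
  using minimal by (auto simp: minimal_shift_space_def shift_space_def)

lemma X_subset: "X \<subseteq> topspace (full_shift A)"
  using closed_X by (rule closedin_subset)

lemma range_subset: "x \<in> X \<Longrightarrow> range x \<subseteq> A"
  using X_subset by (auto simp: topspace_full_shift)

lemma shift_by_X: "x \<in> X \<Longrightarrow> shift_by k x \<in> X"
  by (rule shift_by_mem[OF shift_X])

section \<open>The morphism along segments and orbits\<close>

lemma segment_lists: "x \<in> X \<Longrightarrow> segment x i j \<in> lists A"
  using range_subset[of x] by (auto simp: lists_eq_set set_segment)

lemma \<phi>_closed: "w \<in> lists A \<Longrightarrow> \<phi> w \<in> carrier G"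
  and \<phi>_append: "v \<in> lists A \<Longrightarrow> w \<in> lists A \<Longrightarrow> \<phi> (v @ w) = \<phi> v \<otimes> \<phi> w"
  and \<phi>_Nil: "\<phi> [] = \<one>"
  using morphism
  by (auto simp: onto_monoid_morphism_def epi_def hom_def word_monoid_def)

lemma \<phi>_segment_closed [simp]: "x \<in> X \<Longrightarrow> \<phi> (segment x i j) \<in> carrier G"
  by (simp add: \<phi>_closed segment_lists)

lemma \<phi>_segment_append:
  "x \<in> X \<Longrightarrow> i \<le> j \<Longrightarrow> j \<le> k \<Longrightarrow>
    \<phi> (segment x i j) \<otimes> \<phi> (segment x j k) = \<phi> (segment x i k)"
  by (metis \<phi>_append segment_append segment_lists)

text \<open>The cocycle over the integer action with \<open>cocycle x 1\<close> equal to the image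
  of the letter at 0. For negative \<open>n\<close> the word from \<open>n\<close> to 0 is read
  forwards and its image inverted.\<close>

definition cocycle :: "(int \<Rightarrow> 'a) \<Rightarrow> int \<Rightarrow> 'g" where
  "cocycle x n = (if 0 \<le> n then \<phi> (segment x 0 n) else inv \<phi> (segment x n 0))"

lemma cocycle_closed [simp]: "x \<in> X \<Longrightarrow> cocycle x n \<in> carrier G"
  by (simp add: cocycle_def)

lemma cocycle_0 [simp]: "cocycle x 0 = \<one>"
  by (simp add: cocycle_def \<phi>_Nil)

lemma cocycle_segment:
  assumes "x \<in> X" "i \<le> j"
  shows "cocycle x j = cocycle x i \<otimes> \<phi> (segment x i j)"
proof -
  consider "0 \<le> i" | "i < 0" "0 \<le> j" | "j < 0" by linarith
  then show ?thesis
  proof cases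
    case 1
    then show ?thesis using assms by (simp add: cocycle_def \<phi>_segment_append)
  next
    case 2
    then have "\<phi> (segment x i j) = \<phi> (segment x i 0) \<otimes> \<phi> (segment x 0 j)"
      using assms by (simp add: \<phi>_segment_append)
    then show ?thesis using assms 2 by (simp add: cocycle_def inv_solve_left)
  next
    case 3
    then have "\<phi> (segment x i 0) = \<phi> (segment x i j) \<otimes> \<phi> (segment x j 0)"
      using assms by (simp add: \<phi>_segment_append)
    then show ?thesis
      using assms 3 by (simp add: cocycle_def inv_mult_group m_assoc)
  qed
qed

lemma cocycle_Suc: "x \<in> X \<Longrightarrow> cocycle x (n + 1) = cocycle x n \<otimes> \<phi> [x n]"
  using cocycle_segment[of x n "n + 1"] by simp

text \<open>The cocycle identity for a base point moved by one, solved for the new cocycle and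
  proved by induction in both time directions.\<close>

lemma cocycle_shift:
  assumes "x \<in> X"
  shows "cocycle (shift x) n = inv \<phi> [x 0] \<otimes> cocycle x (n + 1)"
proof -
  have cl: "\<phi> [x i] \<in> carrier G" for i
    using \<phi>_segment_closed[OF assms, of i "i + 1"] by simp
  have sx: "shift x \<in> X" using assms shift_X by blast
  show ?thesis
  proof (induction n rule: int_induct[of _ 0])
    case base
    then show ?case using cl cocycle_Suc[OF assms, of 0] by simp
  next
    case (step1 i)
    have "cocycle (shift x) (i + 1) = inv \<phi> [x 0] \<otimes> cocycle x (i + 1) \<otimes> \<phi> [x (i + 1)]"
      using cocycle_Suc[OF sx, of i] step1 by (simp add: shift_def)
    then show ?case
      using cl assms cocycle_Suc[OF assms, of "i + 1"] by (simp add: m_assoc)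
  next
    case (step2 i)
    \<comment> \<open>In the downward step both sides are first multiplied on the right by the image
      of the letter at \<open>i\<close>, which is then cancelled.\<close>
    have "cocycle (shift x) (i - 1) \<otimes> \<phi> [x i] = cocycle (shift x) i"
      using cocycle_Suc[OF sx, of "i - 1"] by (simp add: shift_def)
    also have "\<dots> = inv \<phi> [x 0] \<otimes> cocycle x i \<otimes> \<phi> [x i]"
      using step2 cl assms by (simp add: cocycle_Suc m_assoc)
    finally show ?case using cl assms sx by simp
  qed
qed

lemma cocycle_cong:
  "(\<And>k. min n 0 \<le> k \<Longrightarrow> k < max n 0 \<Longrightarrow> x k = y k) \<Longrightarrow> cocycle x n = cocycle y n"
  unfolding cocycle_def by (auto intro!: arg_cong[of _ _ \<phi>] segment_cong arg_cong[of _ _ "m_inv G"])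

section \<open>First properties of cobounding maps\<close>

lemma cobounding_iff:
  "cobounding A X G \<phi> H \<alpha> \<longleftrightarrow> subgroup H G \<and> \<alpha> ` X \<subseteq> rcosets H
    \<and> (\<forall>x\<in>X. \<exists>I. finite I \<and> (\<forall>y\<in>X. (\<forall>i\<in>I. y i = x i) \<longrightarrow> \<alpha> y = \<alpha> x))
    \<and> (\<forall>x\<in>X. \<alpha> (shift x) = \<alpha> x #> \<phi> [x 0])"
  unfolding cobounding_def continuous_map_full_shift_discrete_iff[OF X_subset] by blast

lemma cobounding_subgroup: "cobounding A X G \<phi> H \<alpha> \<Longrightarrow> subgroup H G"
  by (simp add: cobounding_def)

lemma cobounding_shift: "cobounding A X G \<phi> H \<alpha> \<Longrightarrow> x \<in> X \<Longrightarrow> \<alpha> (shift x) = \<alpha> x #> \<phi> [x 0]"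
  by (simp add: cobounding_def)

lemma cobounding_locally_constant:
  assumes "cobounding A X G \<phi> H \<alpha>" "x \<in> X"
  obtains I where "finite I" "\<forall>y\<in>X. (\<forall>i\<in>I. y i = x i) \<longrightarrow> \<alpha> y = \<alpha> x"
proof -
  have "\<forall>x\<in>X. \<exists>I. finite I \<and> (\<forall>y\<in>X. (\<forall>i\<in>I. y i = x i) \<longrightarrow> \<alpha> y = \<alpha> x)"
    using assms(1) unfolding cobounding_iff by (elim conjE)
  from bspec[OF this assms(2)] show thesis by (elim exE conjE) (rule that)
qed

lemma cobounding_value:
  assumes "cobounding A X G \<phi> H \<alpha>" "x \<in> X"
  obtains h where "h \<in> carrier G" "\<alpha> x = H #> h"
proof -
  have "\<alpha> x \<in> rcosets H"
    using assms unfolding cobounding_iff by (elim conjE) (rule subsetD, assumption, rule imageI)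
  then show thesis using that by (auto simp: RCOSETS_def)
qed

lemma cobounding_subset: "cobounding A X G \<phi> H \<alpha> \<Longrightarrow> x \<in> X \<Longrightarrow> \<alpha> x \<subseteq> carrier G"
  by (metis cobounding_subgroup cobounding_value r_coset_subset_G subgroup.subset)

lemma cobounding_shift_by:
  assumes "cobounding A X G \<phi> H \<alpha>" "x \<in> X"
  shows "\<alpha> (shift_by n x) = \<alpha> x #> cocycle x n"
proof -
  have cl: "\<phi> [x i] \<in> carrier G" for i
    using \<phi>_segment_closed[OF assms(2), of i "i + 1"] by simp
  have step: "\<alpha> (shift_by (i + 1) x) = \<alpha> (shift_by i x) #> \<phi> [x i]" for i
  proof -
    have "\<alpha> (shift (shift_by i x)) = \<alpha> (shift_by i x) #> \<phi> [shift_by i x 0]"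
      by (rule cobounding_shift[OF assms(1) shift_by_X[OF assms(2)]])
    then show ?thesis by (simp add: shift_eq_shift_by shift_by_def add.commute add.left_commute)
  qed
  note sub = cobounding_subset[OF assms]
  show ?thesis
  proof (induction n rule: int_induct[of _ 0])
    case base
    then show ?case using sub by (simp add: coset_mult_one)
  next
    case (step1 i)
    then show ?case using sub cl assms by (simp add: step cocycle_Suc coset_mult_assoc)
  next
    case (step2 i)
    have sub': "\<alpha> (shift_by (i - 1) x) \<subseteq> carrier G"
      using cobounding_subset[OF assms(1) shift_by_X[OF assms(2)]] .
    have "\<alpha> (shift_by (i - 1) x) #> \<phi> [x (i - 1)] = \<alpha> x #> cocycle x i"
      using step2 step[of "i - 1"] by simp
    also have "\<dots> = \<alpha> x #> cocycle x (i - 1) #> \<phi> [x (i - 1)]"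
      using cocycle_Suc[OF assms(2), of "i - 1"] sub cl assms by (simp add: coset_mult_assoc)
    \<comment> \<open>Multiplying by the inverse letter value undoes one forward step of the
      orbit.\<close>
    finally have "\<alpha> (shift_by (i - 1) x) #> \<phi> [x (i - 1)] #> inv \<phi> [x (i - 1)]
        = \<alpha> x #> cocycle x (i - 1) #> \<phi> [x (i - 1)] #> inv \<phi> [x (i - 1)]" by simp
    then show ?case
      using sub sub' cl assms
      by (simp add: coset_mult_assoc coset_mult_one m_assoc)
  qed
qed

section \<open>Visits to cylinders and return words\<close>

lemma mem_cylinder_shift_by:
  "x \<in> X \<Longrightarrow> shift_by n x \<in> cylinder X u \<longleftrightarrow> occurs_at u x n"
  by (simp add: cylinder_def shift_by_X segment_shift_by add.commute)

text \<open>The points avoiding \<open>u\<close> form a closed invariant proper subset of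
  \<open>X\<close>, hence an empty one. This is where the absence of proper subshifts
  enters.\<close>

lemma word_occurs:
  assumes "u \<in> language X" "x \<in> X"
  obtains n where "occurs_at u x n"
proof -
  let ?Y = "{x \<in> X. \<forall>n. \<not> occurs_at u x n}"
  \<comment> \<open>Invariance under all integer powers yields both inclusions of
    \<open>shift\<close> applied to \<open>?Y\<close>.\<close>
  have inv: "shift_by k y \<in> ?Y" if "y \<in> ?Y" for y k
  proof -
    have "occurs_at u (shift_by k y) n \<longleftrightarrow> occurs_at u y (n + k)" for n
      by (simp add: segment_shift_by algebra_simps)
    then show ?thesis using that shift_by_X by simp
  qed
  have "shift ` ?Y = ?Y"
  proof
    show "shift ` ?Y \<subseteq> ?Y" using inv by (auto simp: shift_eq_shift_by)
    show "?Y \<subseteq> shift ` ?Y"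
    proof
      fix y assume "y \<in> ?Y"
      then have "shift_by (- 1) y \<in> ?Y" by (rule inv)
      then show "y \<in> shift ` ?Y"
        by (intro image_eqI[of _ _ "shift_by (- 1) y"]) (simp_all add: shift_eq_shift_by)
    qed
  qed
  moreover have "?Y \<noteq> X"
  proof -
    obtain y i j where y: "y \<in> X" "i \<le> j" "u = segment y i j"
      using assms(1) by (auto simp: language_def)
    then have "occurs_at u y i" by simp
    with y show ?thesis by blast
  qed
  moreover have "?Y \<subseteq> X" by blast
  ultimately have "?Y = {}"
    using minimal closedin_avoiding_word[OF closed_X, of u]
    unfolding minimal_shift_space_def by meson
  then show thesis using assms(2) that by blast
qed

text \<open>Two consecutive occurrences of \<open>u\<close> enclose a return word, so the word between any two
  occurrences is a product of return words.\<close>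
lemma \<phi>_between_occurrences:
  assumes "subgroup K G" "\<phi> ` return_words X u \<subseteq> K" "x \<in> X"
    and "occurs_at u x n" "occurs_at u x m" "n \<le> m"
  shows "\<phi> (segment x n m) \<in> K"
  using assms(4-6)
proof (induction "nat (m - n)" arbitrary: n rule: less_induct)
  case less
  show ?case
  proof (cases "n = m")
    case True
    then show ?thesis using assms(1) by (simp add: \<phi>_Nil subgroup.one_closed)
  next
    case False
    \<comment> \<open>\<open>k\<close> is the distance from \<open>n\<close> to the next occurrence
      of \<open>u\<close>; it exists because \<open>m\<close> is a later occurrence.\<close>
    define P where "P k \<longleftrightarrow> 0 < k \<and> occurs_at u x (n + int k)" for k
    define k where "k = (LEAST k. P k)"
    have Pm: "P (nat (m - n))" using less.prems False by (simp add: P_def)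
    have Pk: "P k" unfolding k_def by (rule LeastI, rule Pm)
    have km: "k \<le> nat (m - n)" unfolding k_def by (rule Least_le, rule Pm)
    have min: "k \<le> j" if "P j" for j unfolding k_def by (rule Least_le, rule that)
    let ?r = "segment x n (n + int k)"
    \<comment> \<open>\<open>?r @ u\<close> is itself a window of \<open>x\<close>, so its
      occurrences of \<open>u\<close> are visits of \<open>x\<close> at times \<open>n\<close> to
      \<open>n + k\<close>, even if the two end copies of \<open>u\<close> overlap.\<close>
    have ru: "?r @ u = segment x n (n + int k + int (length u))"
      using segment_append[of n "n + int k" "n + int k + int (length u)" x] Pk
      by (simp add: P_def)
    have "?r @ u \<in> language X"
      unfolding ru using assms(3) by (simp add: segment_in_language)
    moreover have "occurrences u (?r @ u) = {0, length ?r}"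
      unfolding ru occurrences_segment
    proof (intro equalityI subsetI)
      fix i assume i: "i \<in> {i. i + length u \<le> nat (n + int k + int (length u) - n)
          \<and> occurs_at u x (n + int i)}"
      then have "i \<le> k" by auto
      moreover have "k \<le> i" if "i > 0" using i that by (intro min) (simp add: P_def)
      ultimately show "i \<in> {0, length ?r}" by auto
    next
      fix i assume "i \<in> {0, length ?r}"
      then show "i \<in> {i. i + length u \<le> nat (n + int k + int (length u) - n)
          \<and> occurs_at u x (n + int i)}"
        using Pk less.prems(1) by (auto simp: P_def)
    qed
    moreover have "?r \<noteq> []" using Pk by (metis P_def length_0_conv length_segment
          add_diff_cancel_left' nat_int less_irrefl)
    ultimately have "?r \<in> return_words X u" by (simp add: return_words_def)
    then have "\<phi> ?r \<in> K" using assms(2) by blast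
    moreover have "\<phi> (segment x (n + int k) m) \<in> K"
      using less.hyps[of "n + int k"] Pk km less.prems by (auto simp: P_def)
    moreover have "\<phi> (segment x n m) = \<phi> ?r \<otimes> \<phi> (segment x (n + int k) m)"
      using km less.prems by (subst \<phi>_segment_append[OF assms(3)]) auto
    ultimately show ?thesis using subgroup.m_closed[OF assms(1)] by simp
  qed
qed

text \<open>A point reading \<open>r @ u\<close> from 0 lies in the cylinder at times 0 and
  \<open>length r\<close>. Comparing the two values of \<alpha> shows that the image of
  \<open>r\<close> stabilises the coset \<open>H #> g\<close>.\<close>

lemma return_words_subset_conjugate:
  assumes "cobounding A X G \<phi> H \<alpha>" "g \<in> carrier G"
    and const: "\<forall>x\<in>cylinder X u. \<alpha> x = H #> g"
  shows "\<phi> ` return_words X u \<subseteq> (inv g <# H) #> g"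
proof
  fix a assume "a \<in> \<phi> ` return_words X u"
  then obtain r where r: "r \<in> return_words X u" "a = \<phi> r" by blast
  note H = cobounding_subgroup[OF assms(1)]
  obtain x i j where x: "x \<in> X" "i \<le> j" "r @ u = segment x i j"
    using r by (auto simp: return_words_def language_def)
  define y where "y = shift_by i x"
  have y: "y \<in> X" "r @ u = segment y 0 (int (length r + length u))"
  proof -
    show "y \<in> X" using x by (simp add: y_def shift_by_X)
    have "int (length r + length u) = j - i"
      using x(2) arg_cong[OF x(3), of length] by simp
    then show "r @ u = segment y 0 (int (length r + length u))"
      using x(3) by (simp add: y_def segment_shift_by)
  qed
  have "{0, length r} \<subseteq> occurrences u (segment y 0 (int (length r + length u)))"
    using r unfolding y(2)[symmetric] return_words_def by simp
  then have "occurs_at u y 0" "occurs_at u y (int (length r))"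
    by (auto simp: occurrences_segment)
  then have "y \<in> cylinder X u" "shift_by (int (length r)) y \<in> cylinder X u"
    using y(1) mem_cylinder_shift_by[of y 0] mem_cylinder_shift_by[of y "int (length r)"] by auto
  then have "\<alpha> y = H #> g" "\<alpha> (shift_by (int (length r)) y) = H #> g"
    using const by auto
  moreover have "segment y 0 (int (length r)) = r"
    using arg_cong[OF y(2), of "take (length r)"]
      take_drop_segment[of 0 "length r" "int (length r + length u)" 0 y] by simp
  then have "cocycle y (int (length r)) = a" by (simp add: cocycle_def r)
  ultimately have eq: "H #> g = H #> g #> a"
    using cobounding_shift_by[OF assms(1) y(1), of "int (length r)"] by simp
  have a: "a \<in> carrier G"
    using \<open>cocycle y (int (length r)) = a\<close> y(1) cocycle_closed by blast
  have "H #> (g \<otimes> a) = H #> g"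
    using eq a assms(2) H by (simp add: coset_mult_assoc subgroup.subset)
  then have "g \<otimes> a \<otimes> inv g \<in> H" using rcos_eq_iff[OF H] a assms(2) by simp
  then show "a \<in> (inv g <# H) #> g"
    using mem_conjugate_iff a assms(2) subgroup.subset[OF H] by blast
qed

text \<open>The value at \<open>x\<close> is transported back from any visit to the cylinder. A
  general \<open>g\<close> is allowed so that the new map can be compared with a given one on the
  same cylinder.\<close>

lemma cobounding_exists:
  assumes H: "subgroup H G" and g: "g \<in> carrier G" and u: "u \<in> language X"
    and ret: "\<phi> ` return_words X u \<subseteq> (inv g <# H) #> g"
  obtains \<alpha> where "cobounding A X G \<phi> H \<alpha>" "\<forall>x\<in>cylinder X u. \<alpha> x = H #> g"
proof -
  \<comment> \<open>Independence of the visit: between two visits the cocycle changes by a factor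
    lying in the conjugate of \<open>H\<close> by \<open>g\<close>.\<close>
  have le: "H #> (g \<otimes> inv cocycle x m) = H #> (g \<otimes> inv cocycle x n)"
    if "x \<in> X" "occurs_at u x n" "occurs_at u x m" "n \<le> m" for x n m
  proof -
    define a where "a = \<phi> (segment x n m)"
    have a: "a \<in> carrier G" "g \<otimes> a \<otimes> inv g \<in> H"
      using \<phi>_between_occurrences[OF subgroup_conjugate[OF H g] ret that]
        mem_conjugate_iff[OF subgroup.subset[OF H] g] a_def by auto
    have m: "cocycle x m = cocycle x n \<otimes> a"
      using cocycle_segment that a_def by simp
    have "g \<otimes> inv cocycle x n \<otimes> inv (g \<otimes> inv cocycle x m)
        = g \<otimes> (inv cocycle x n \<otimes> cocycle x n) \<otimes> a \<otimes> inv g"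
      using a(1) g that(1) unfolding m
      by (simp add: inv_mult_group m_assoc) (simp add: m_assoc[symmetric])
    also have "\<dots> = g \<otimes> a \<otimes> inv g" using a g that(1) by simp
    finally have "g \<otimes> inv cocycle x n \<otimes> inv (g \<otimes> inv cocycle x m) \<in> H" using a by simp
    then have "H #> (g \<otimes> inv cocycle x n) = H #> (g \<otimes> inv cocycle x m)"
      using rcos_eq_iff[OF H, of "g \<otimes> inv cocycle x n" "g \<otimes> inv cocycle x m"] g that(1) by simp
    then show ?thesis by simp
  qed
  define \<alpha> where "\<alpha> x = H #> (g \<otimes> inv cocycle x (SOME n. occurs_at u x n))" for x
  have \<alpha>: "\<alpha> x = H #> (g \<otimes> inv cocycle x n)" if "x \<in> X" "occurs_at u x n" for x n
  proof -
    define m where "m = (SOME n. occurs_at u x n)"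
    have m: "occurs_at u x m" unfolding m_def using that(2) by (rule someI)
    have "\<alpha> x = H #> (g \<otimes> inv cocycle x m)" by (simp add: \<alpha>_def m_def)
    also have "\<dots> = H #> (g \<otimes> inv cocycle x n)"
      using le[OF that(1) that(2) m] le[OF that(1) m that(2)] by (cases "n \<le> m") simp_all
    finally show ?thesis .
  qed
  have "cobounding A X G \<phi> H \<alpha>"
    unfolding cobounding_iff
  proof (intro conjI ballI H)
    show "\<alpha> ` X \<subseteq> rcosets H"
      using g H by (auto simp: \<alpha>_def intro!: rcosetsI subgroup.subset)
  next
    fix x assume x: "x \<in> X"
    obtain n where n: "occurs_at u x n" using word_occurs[OF u x] .
    \<comment> \<open>This window covers both the occurrence of \<open>u\<close> at \<open>n\<close>
      and the stretch between 0 and \<open>n\<close> that determines the cocycle.\<close>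
    let ?I = "{min n 0..max n 0 + int (length u)}"
    have "\<alpha> y = \<alpha> x" if y: "y \<in> X" "\<forall>i\<in>?I. y i = x i" for y
    proof -
      have "segment y n (n + int (length u)) = segment x n (n + int (length u))"
        by (intro segment_cong y(2)[rule_format]) auto
      moreover have "cocycle y n = cocycle x n"
        by (intro cocycle_cong y(2)[rule_format]) auto
      ultimately show ?thesis using \<alpha>[of x n] \<alpha>[of y n] x y n by simp
    qed
    then show "\<exists>I. finite I \<and> (\<forall>y\<in>X. (\<forall>i\<in>I. y i = x i) \<longrightarrow> \<alpha> y = \<alpha> x)"
      by (intro exI[of _ ?I]) blast
  next
    fix x assume x: "x \<in> X"
    obtain n where n: "occurs_at u x n" using word_occurs[OF u x] .
    have sx: "shift x \<in> X" using x shift_X by blast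
    have cl: "\<phi> [x 0] \<in> carrier G"
      using \<phi>_segment_closed[OF x, of 0 1] segment_single[of x 0] by simp
    \<comment> \<open>A visit of \<open>x\<close> at time \<open>n\<close> is a visit of
      \<open>shift x\<close> at time \<open>n - 1\<close>.\<close>
    have "occurs_at u (shift x) (n - 1)"
      using n by (simp add: shift_eq_shift_by segment_shift_by algebra_simps)
    then have "\<alpha> (shift x) = H #> (g \<otimes> inv (inv \<phi> [x 0] \<otimes> cocycle x n))"
      using \<alpha>[OF sx] cocycle_shift[OF x, of "n - 1"] by simp
    also have "\<dots> = H #> (g \<otimes> inv cocycle x n \<otimes> \<phi> [x 0])"
      using cl g x by (simp add: inv_mult_group m_assoc)
    also have "\<dots> = \<alpha> x #> \<phi> [x 0]"
      using \<alpha>[OF x n] cl g x H by (simp add: coset_mult_assoc subgroup.subset)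
    finally show "\<alpha> (shift x) = \<alpha> x #> \<phi> [x 0]" .
  qed
  moreover have "\<forall>x\<in>cylinder X u. \<alpha> x = H #> g"
    \<comment> \<open>On the cylinder itself the visit time 0 can be taken, where the cocycle is
      trivial.\<close>
    using \<alpha>[of _ 0] g by (auto simp: cylinder_def)
  ultimately show thesis using that by blast
qed

section \<open>Comparison of cobounding maps and minimality\<close>

text \<open>Local constancy gives a window around 0, whereas cylinders start at 0. Shifting by
  \<open>- N\<close> repairs this, since the same window also fixes the cocycle that relates the two
  values.\<close>

lemma cobounding_constant_on_cylinder:
  assumes "cobounding A X G \<phi> K \<beta>"
  obtains u g where "u \<in> language X" "g \<in> carrier G" "\<forall>x\<in>cylinder X u. \<beta> x = K #> g"
proof -
  obtain x where x: "x \<in> X"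
    using minimal by (auto simp: minimal_shift_space_def shift_space_def)
  obtain I where I: "finite I" "\<forall>y\<in>X. (\<forall>i\<in>I. y i = x i) \<longrightarrow> \<beta> y = \<beta> x"
    using cobounding_locally_constant[OF assms x] .
  \<comment> \<open>The added 1 is needed because the window from \<open>- N\<close> to
    \<open>N\<close> omits its right end; inserting 0 covers an empty \<open>I\<close>.\<close>
  define N where "N = Max (insert 0 (abs ` I)) + 1"
  have N: "\<bar>i\<bar> < N" if "i \<in> I" for i
    using I(1) that by (simp add: N_def less_Suc_eq_le zle_add1_eq_le)
  have N0: "0 < N" using I(1) by (simp add: N_def zle_add1_eq_le)
  define u where "u = segment x (- N) N"
  have len: "int (length u) = 2 * N" using N0 by (simp add: u_def)
  have "u \<in> language X" using x N0 by (simp add: u_def segment_in_language)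
  obtain g where g: "g \<in> carrier G" "\<beta> (shift_by (- N) x) = K #> g"
    using cobounding_value[OF assms shift_by_X[OF x]] .
  have "\<beta> y = K #> g" if "y \<in> cylinder X u" for y
  proof -
    define z where "z = shift_by N y"
    have y: "y \<in> X" "segment y 0 (2 * N) = u"
      using that len by (auto simp: cylinder_def)
    have z: "z \<in> X" using y by (simp add: z_def shift_by_X)
    have "segment z (- N) N = segment x (- N) N"
      using y(2) by (simp add: z_def segment_shift_by u_def)
    then have eq: "z i = x i" if "- N \<le> i" "i < N" for i
      using that nth_segment[of "nat (i + N)" N "- N" z] nth_segment[of "nat (i + N)" N "- N" x]
      by simp
    have "\<beta> z = \<beta> x" by (intro I(2)[rule_format, OF z] eq) (auto dest!: N)
    moreover have "cocycle z (- N) = cocycle x (- N)"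
      by (rule cocycle_cong) (use eq N0 in auto)
    ultimately have "\<beta> (shift_by (- N) z) = \<beta> (shift_by (- N) x)"
      using cobounding_shift_by[OF assms] x z by simp
    then show ?thesis using g by (simp add: z_def)
  qed
  with \<open>u \<in> language X\<close> g that show thesis by blast
qed

text \<open>Agreement on one cylinder suffices because every orbit meets it.\<close>
lemma cobounding_leI:
  assumes \<beta>: "cobounding A X G \<phi> K \<beta>" and \<alpha>: "cobounding A X G \<phi> H \<alpha>" and "K \<subseteq> H"
    and u: "u \<in> language X" and g: "g \<in> carrier G"
    and "\<forall>x\<in>cylinder X u. \<beta> x = K #> g" "\<forall>x\<in>cylinder X u. \<alpha> x = H #> g"
  shows "cobounding_le X G K \<beta> H \<alpha>"
  unfolding cobounding_le_def
proof (intro conjI ballI subsetI)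
  fix h x assume h: "h \<in> carrier G" and "x \<in> {x \<in> X. \<beta> x = K #> h}"
  then have x: "x \<in> X" "\<beta> x = K #> h" by auto
  note K = cobounding_subgroup[OF \<beta>] and H = cobounding_subgroup[OF \<alpha>]
  obtain n where "occurs_at u x n" using word_occurs[OF u x(1)] .
  then have "shift_by n x \<in> cylinder X u" using mem_cylinder_shift_by[OF x(1)] by simp
  then have "K #> g = \<beta> x #> cocycle x n" and \<alpha>g: "H #> g = \<alpha> x #> cocycle x n"
    using assms(6,7) cobounding_shift_by[OF \<beta> x(1)] cobounding_shift_by[OF \<alpha> x(1)] by auto
  then have "K #> (h \<otimes> cocycle x n) = K #> g"
    using x h K by (simp add: coset_mult_assoc subgroup.subset)
  \<comment> \<open>Equality of cosets of \<open>K\<close> becomes membership in \<open>K\<close>,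
    hence in \<open>H\<close>, and so equality of cosets of \<open>H\<close>.\<close>
  then have "h \<otimes> cocycle x n \<otimes> inv g \<in> K"
    using rcos_eq_iff[OF K] x(1) h g by simp
  then have "H #> (h \<otimes> cocycle x n) = H #> g"
    using rcos_eq_iff[OF H] x(1) h g \<open>K \<subseteq> H\<close> by auto
  then have "\<alpha> x #> cocycle x n #> inv cocycle x n = H #> (h \<otimes> cocycle x n) #> inv cocycle x n"
    using \<alpha>g by simp
  then have "\<alpha> x = H #> h"
    using x(1) h H cobounding_subset[OF \<alpha> x(1)]
    by (simp add: coset_mult_assoc subgroup.subset m_assoc coset_mult_one)
  then show "x \<in> {x \<in> X. \<alpha> x = H #> h}" using x by simp
qed (use \<open>K \<subseteq> H\<close> in auto)

text \<open>If the return words generated less than the conjugate of \<open>H\<close>, the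
  construction above would give a strictly smaller cobounding map.\<close>

lemma minimal_cobounding_generate:
  assumes min: "minimal_cobounding A X G \<phi> H \<alpha>" and u: "u \<in> language X" and g: "g \<in> carrier G"
    and const: "\<forall>x\<in>cylinder X u. \<alpha> x = H #> g"
  shows "generate G (\<phi> ` return_words X u) = (inv g <# H) #> g"
proof -
  have \<alpha>: "cobounding A X G \<phi> H \<alpha>" using min by (simp add: minimal_cobounding_def)
  note H = cobounding_subgroup[OF \<alpha>]
  note conj = subgroup_conjugate[OF H g]
  define L where "L = generate G (\<phi> ` return_words X u)"
  \<comment> \<open>Conjugating back by \<open>g\<close> makes \<open>L\<close> the conjugate of
    \<open>K\<close> by \<open>g\<close>, so the new map takes the value \<open>K #> g\<close> on
    the cylinder of \<open>u\<close>.\<close>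
  define K where "K = g <# L #> inv g"
  have ret: "\<phi> ` return_words X u \<subseteq> (inv g <# H) #> g"
    by (rule return_words_subset_conjugate[OF \<alpha> g const])
  have LH: "L \<subseteq> (inv g <# H) #> g"
    unfolding L_def by (rule generate_subgroup_incl[OF ret conj])
  have L: "subgroup L G"
    unfolding L_def using ret subgroup.subset[OF conj] by (intro generate_is_subgroup) blast
  have K: "subgroup K G"
    unfolding K_def using subgroup_conjugate[OF L inv_closed[OF g]] g by simp
  have KL: "(inv g <# K) #> g = L"
    unfolding K_def using subgroup.subset[OF L] g by (rule conjugate_conjugate_inv)
  have "K \<subseteq> H"
  proof
    fix k assume "k \<in> K"
    then have k: "k \<in> carrier G" "inv g \<otimes> k \<otimes> g \<in> L"
      using mem_conjugate_iff[OF subgroup.subset[OF L] inv_closed[OF g]] g by (auto simp: K_def)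
    then have "g \<otimes> (inv g \<otimes> k \<otimes> g) \<otimes> inv g \<in> H"
      using LH mem_conjugate_iff[OF subgroup.subset[OF H] g] by blast
    moreover have "g \<otimes> (inv g \<otimes> k \<otimes> g) \<otimes> inv g = k"
      using k g by (simp add: m_assoc) (simp add: m_assoc[symmetric])
    ultimately show "k \<in> H" by simp
  qed
  have "\<phi> ` return_words X u \<subseteq> (inv g <# K) #> g"
    unfolding KL L_def by (auto intro: generate.incl)
  then obtain \<beta> where \<beta>: "cobounding A X G \<phi> K \<beta>" "\<forall>x\<in>cylinder X u. \<beta> x = K #> g"
    by (rule cobounding_exists[OF K g u])
  have "cobounding_le X G K \<beta> H \<alpha>"
    by (rule cobounding_leI[OF \<beta>(1) \<alpha> \<open>K \<subseteq> H\<close> u g \<beta>(2) const])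
  then have "K = H" using min \<beta>(1) by (auto simp: minimal_cobounding_def)
  with KL show ?thesis by (simp add: L_def)
qed

text \<open>Where a smaller map \<beta> is constant on a cylinder, so is \<alpha>, with the same
  \<open>g\<close>. The return words then generate the conjugate of \<open>H\<close>, yet lie in
  that of \<open>K\<close>, which forces \<open>H\<close> into \<open>K\<close>.\<close>

lemma minimal_coboundingI:
  assumes \<alpha>: "cobounding A X G \<phi> H \<alpha>"
    and gen: "\<And>u g. u \<in> language X \<Longrightarrow> g \<in> carrier G \<Longrightarrow> \<forall>x\<in>cylinder X u. \<alpha> x = H #> g \<Longrightarrow>
      generate G (\<phi> ` return_words X u) = (inv g <# H) #> g"
  shows "minimal_cobounding A X G \<phi> H \<alpha>"
  unfolding minimal_cobounding_def
proof (intro conjI \<alpha> allI impI)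
  fix K \<beta> assume "cobounding A X G \<phi> K \<beta> \<and> cobounding_le X G K \<beta> H \<alpha>"
  then have \<beta>: "cobounding A X G \<phi> K \<beta>" and "K \<subseteq> H"
    and le: "\<And>x h. x \<in> X \<Longrightarrow> h \<in> carrier G \<Longrightarrow> \<beta> x = K #> h \<Longrightarrow> \<alpha> x = H #> h"
    unfolding cobounding_le_def by blast+
  note K = cobounding_subgroup[OF \<beta>] and H = cobounding_subgroup[OF \<alpha>]
  obtain u g where u: "u \<in> language X" and g: "g \<in> carrier G"
    and const: "\<forall>x\<in>cylinder X u. \<beta> x = K #> g"
    using cobounding_constant_on_cylinder[OF \<beta>] .
  have "\<forall>x\<in>cylinder X u. \<alpha> x = H #> g"
    using const le g by (auto simp: cylinder_def)
  then have "(inv g <# H) #> g = generate G (\<phi> ` return_words X u)"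
    using gen u g by simp
  also have "\<dots> \<subseteq> (inv g <# K) #> g"
    by (intro generate_subgroup_incl return_words_subset_conjugate[OF \<beta> g const]
        subgroup_conjugate K g)
  finally have HK: "(inv g <# H) #> g \<subseteq> (inv g <# K) #> g" .
  have "H \<subseteq> K"
  proof
    fix h assume h: "h \<in> H"
    then have hc: "h \<in> carrier G" using subgroup.subset[OF H] by blast
    have "g \<otimes> (inv g \<otimes> h \<otimes> g) \<otimes> inv g = h"
      using hc g by (simp add: m_assoc) (simp add: m_assoc[symmetric])
    moreover have "inv g \<otimes> h \<otimes> g \<in> (inv g <# H) #> g"
      using h unfolding l_coset_def r_coset_def by blast
    ultimately show "h \<in> K"
      using HK mem_conjugate_iff[OF subgroup.subset[OF K] g] by (metis subsetD)
  qed
  with \<open>K \<subseteq> H\<close> show "K = H" by blast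
  \<comment> \<open>Every value of \<beta> has the form \<open>K #> h\<close>, and the order gives
    \<alpha> the value \<open>H #> h\<close> there, now the same coset.\<close>
  then show "\<forall>x\<in>X. \<beta> x = \<alpha> x"
    using le cobounding_value[OF \<beta>] by metis
qed

end

theorem proposition7p8:
  fixes A :: "'a set" and X :: "(int \<Rightarrow> 'a) set"
    and G :: "('g, 'm) monoid_scheme" and \<phi> :: "'a list \<Rightarrow> 'g" and H :: "'g set"
  assumes "finite A" and "minimal_shift_space A X"
    and "group G" and "finite (carrier G)"
    and "onto_monoid_morphism A G \<phi>"
    and "subgroup H G"
  shows "(\<forall>\<alpha> u g. cobounding A X G \<phi> H \<alpha> \<and> u \<in> language X \<and> g \<in> carrier G
            \<and> (\<forall>x\<in>cylinder X u. \<alpha> x = H #>\<^bsub>G\<^esub> g)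
          \<longrightarrow> \<phi> ` return_words X u \<subseteq> (inv\<^bsub>G\<^esub> g <#\<^bsub>G\<^esub> H) #>\<^bsub>G\<^esub> g)
    \<and> (\<forall>u\<in>language X. \<phi> ` return_words X u \<subseteq> H
          \<longrightarrow> (\<exists>\<alpha>. cobounding A X G \<phi> H \<alpha> \<and> (\<forall>x\<in>cylinder X u. \<alpha> x = H)))
    \<and> (\<forall>\<alpha>. cobounding A X G \<phi> H \<alpha> \<longrightarrow>
          (minimal_cobounding A X G \<phi> H \<alpha> \<longleftrightarrow>
            (\<forall>u\<in>language X. \<forall>g\<in>carrier G. (\<forall>x\<in>cylinder X u. \<alpha> x = H #>\<^bsub>G\<^esub> g)
               \<longrightarrow> generate G (\<phi> ` return_words X u) = (inv\<^bsub>G\<^esub> g <#\<^bsub>G\<^esub> H) #>\<^bsub>G\<^esub> g)))"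
proof -
  interpret minimal_shift_morphism G A X \<phi>
    by (rule minimal_shift_morphism.intro)
      (simp_all add: assms minimal_shift_morphism_axioms_def)
  have H: "H \<subseteq> carrier G" using assms(6) by (rule subgroup.subset)
  have ii: "\<exists>\<alpha>. cobounding A X G \<phi> H \<alpha> \<and> (\<forall>x\<in>cylinder X u. \<alpha> x = H)"
    if "u \<in> language X" "\<phi> ` return_words X u \<subseteq> H" for u
  proof -
    \<comment> \<open>Part (ii) is the construction with \<open>g\<close> equal to the unit, where
      conjugation changes nothing.\<close>
    have "\<phi> ` return_words X u \<subseteq> (inv\<^bsub>G\<^esub> \<one>\<^bsub>G\<^esub> <#\<^bsub>G\<^esub> H) #>\<^bsub>G\<^esub> \<one>\<^bsub>G\<^esub>"
      using that(2) H by (simp add: lcos_mult_one coset_mult_one)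
    then show ?thesis
      using cobounding_exists[OF assms(6) one_closed that(1)] H by (metis coset_mult_one)
  qed
  show ?thesis
  proof (intro conjI allI impI ballI)
    fix \<alpha> assume \<alpha>: "cobounding A X G \<phi> H \<alpha>"
    show "minimal_cobounding A X G \<phi> H \<alpha> \<longleftrightarrow>
        (\<forall>u\<in>language X. \<forall>g\<in>carrier G. (\<forall>x\<in>cylinder X u. \<alpha> x = H #>\<^bsub>G\<^esub> g)
           \<longrightarrow> generate G (\<phi> ` return_words X u) = (inv\<^bsub>G\<^esub> g <#\<^bsub>G\<^esub> H) #>\<^bsub>G\<^esub> g)"
      using minimal_cobounding_generate minimal_coboundingI[OF \<alpha>] by blast
  qed (elim conjE, rule return_words_subset_conjugate, assumption+, rule ii)
qed

end
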